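(* Let $\omega_1,\omega_2>0$, $\boldsymbol\omega=(\omega_1,\omega_2)$, $\alpha\in\mathbb C$, integers $0\le m\le q$, $0\le n\le p$, ${\bf a}\in\mathbb C^p$, ${\bf b}\in\mathbb C^q$. Put $\tau=\omega_2/\omega_1$, $\eta=\alpha-N\ln(\omega_2)/(2\pi)$, $\tilde a_j=b_{q-j+1}/\omega_1$ ($1\le j\le q$), $\tilde b_j=a_{p-j+1}/\omega_1$ ($1\le j\le p$), where $N=2(m+n)-p-q$, and $$C_1=(2\pi)^{((\omega_1+\omega_2)(m+n-q)-\nu)/(2\omega_1)}\,\omega_2^{-N-\xi/(2\omega_1\omega_2)+\mu(\omega_1+\omega_2)/(2\omega_1\omega_2)}\,\omega_1,\qquad C_2=(2\pi)^{(q-p)/2}\,\omega_2^{(N(\omega_1+\omega_2)/2-\mu)/\omega_2}.$$ Assume that the parameters of $K_{q,p}^{p-n,q-m}\Big(\begin{matrix} \tilde{\bf a} \\ \tilde{\bf b} \end{matrix}\Big\vert\cdot\,;\tau,\eta\Big)$ are admissible. Then for $z>0$ (with $z\neq1$ if these parameters fall in case (vii)), $$\tilde K_{p,q}^{m,n}\Big(\begin{matrix} a_1,\dots,a_p \\ {b_1},\dots,b_q \end{matrix}\Big\vert z;\boldsymbol\omega,\alpha\Big)=C_1\,K_{q,p}^{p-n,q-m}\Big(\begin{matrix} \tilde a_1,\dots,\tilde a_q \\ \tilde b_1,\dots,\tilde b_p \end{matrix}\Big\vert C_2z^{\omega_1};\tau,\eta\Big).$$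
   Context: Notation for the original parameters $(m,n,p,q,{\bf a},{\bf b})$: $\nu=\sum_{j=1}^pa_j-\sum_{j=1}^qb_j$, $\mu=\sum_{j=1}^na_j-\sum_{j=n+1}^pa_j+\sum_{j=1}^mb_j-\sum_{j=m+1}^qb_j$, $\xi=\sum_{j=1}^na_j^2-\sum_{j=n+1}^pa_j^2+\sum_{j=1}^mb_j^2-\sum_{j=m+1}^qb_j^2$. Barnes double gamma function. For $\tau\in\mathbb C\setminus(-\infty,0]$ let $\psi=\Gamma'/\Gamma$, let $\gamma_E=-\psi(1)$, $$C(\tau)=\lim_{k\to\infty}\Big[\sum_{j=1}^{k-1}\psi(j\tau)+\tfrac12\psi(k\tau)-\tfrac1\tau\ln\frac{\Gamma(k\tau)}{\sqrt{2\pi}}\Big],\quad D(\tau)=\lim_{k\to\infty}\Big[\sum_{j=1}^{k-1}\psi'(j\tau)+\tfrac12\psi'(k\tau)-\tfrac1\tau\psi(k\tau)\Big],$$ $a(\tau)=\gamma_E\tau+\frac{\tau}{2}\ln(2\pi\tau)+\frac12\ln\tau-\tau C(\tau)$, $b(\tau)=-\frac{\pi^2\tau^2}{6}-\tau\ln\tau-\tau^2D(\tau)$, and $$G(z;\tau)=\frac z\tau e^{a(\tau)\frac z\tau+b(\tau)\frac{z^2}{2\tau^2}}\prod_{k,l\ge0,\,(k,l)\ne(0,0)}\Big(1+\frac z{k\tau+l}\Big)e^{-\frac z{k\tau+l}+\frac{z^2}{2(k\tau+l)^2}} .$$ Symmetric double gamma function: for $\omega_1,\omega_2>0$, $$\Gamma_2(z;\omega_1,\omega_2)=(2\pi)^{\frac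 z{2\omega_1}}\omega_2^{-\frac{z^2}{2\omega_1\omega_2}+\frac{z(\omega_1+\omega_2)}{2\omega_1\omega_2}-1}G\Big(\frac z{\omega_1};\frac{\omega_2}{\omega_1}\Big)^{-1}.$$ $K$-function. In this paragraph $(m,n,p,q,{\bf a},{\bf b},\alpha)$ are generic: $\tau>0$, $\alpha\in\mathbb C$, $0\le m\le q$, $0\le n\le p$, ${\bf a}\in\mathbb C^p$, ${\bf b}\in\mathbb C^q$, with $N=2(m+n)-p-q$, $\mu=\sum_{j=1}^na_j-\sum_{j=n+1}^pa_j+\sum_{j=1}^mb_j-\sum_{j=m+1}^qb_j$ and $\nu=\sum_{j=1}^pa_j-\sum_{j=1}^qb_j$ formed from these generic parameters. Put $$\mathcal G(s)=\frac{\prod_{j=1}^mG(b_j-s;\tau)\prod_{j=1}^nG(1+\tau-a_j+s;\tau)}{\prod_{j=m+1}^qG(1+\tau-b_j+s;\tau)\prod_{j=n+1}^pG(a_j-s;\tau)},$$ $\Lambda^+=\{a_j+l\tau+k: n+1\le j\le p,\ l,k\ge0\}$, $\Lambda^-=\{b_j-l\tau-k: m+1\le j\le q,\ l,k\ge1\}$ ($l,k$ integers). Assume $\Lambda^+\cap\Lambda^-=\emptyset$. For $\theta^+\in(0,\pi)$, $\theta^-\in(-\pi,0)$, $\mathcal L_{\theta^-,\theta^+}$ denotes a simple contour dividing the plane into two domains, one containing $\Lambda^+$ and all large positive numbers and the other containing $\Lambda^-$, oriented so that $\Lambda^-$ is on the left, and which for large $|s|$ coincides with a ray $c_++re^{i\theta^+}$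 in the upper half-plane and a ray $c_-+re^{i\theta^-}$ in the lower half-plane. Then $$K_{p,q}^{m,n}\Big(\begin{matrix} {\bf a} \\ {\bf b} \end{matrix}\Big\vert z;\tau,\alpha\Big)=\frac1{2\pi i}\int_{\gamma}\mathcal G(s)e^{\frac{\pi\alpha}\tau s^2}z^{-s}\,ds,\qquad\gamma=\mathcal L_{\theta^-,\theta^+},$$ with $\theta^\pm$ chosen as follows (the value does not depend on the choice within these rules): (i) $N>0$: any $\theta^+\in(\pi/4,3\pi/4)$, $\theta^-\in(-3\pi/4,-\pi/4)$. (ii) $N=0$, $\mathrm{Re}(\alpha)\ge0$, $4\alpha\ne\pm(p-q)i$: any $\theta^+\in(0,\pi)$ with $\mathrm{Re}((\alpha+(p-q)i/4)s^2)<0$ on $\arg s=\theta^+$, any $\theta^-\in(-\pi,0)$ with $\mathrm{Re}((\alpha-(p-q)i/4)s^2)<0$ on $\arg s=\theta^-$. (iii) $N=0$, $4\alpha=(q-p)i\ne0$, $\mu\neq 0$, $\arg\mu\ne\pi/2$: any $\theta^+\in(0,\pi)$ with $\mathrm{Re}(\mu s)>0$ on $\arg s=\theta^+$, any $\theta^-\in(-\pi,0)$ with $\mathrm{Re}(i(q-p)s^2)<0$ on $\arg s=\theta^-$. (iv) $N=0$, $4\alpha=(p-q)i\ne0$, $\mu\ne0$, $\arg\mu\ne-\pi/2$: any $\theta^+\in(0,\pi)$ with $\mathrm{Re}(i(p-q)s^2)<0$ on $\arg s=\theta^+$, any $\theta^-\in(-\pi,0)$ with $\mathrm{Re}(\mu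 s)>0$ on $\arg s=\theta^-$. (v) $N=\alpha=p-q=0$, $\mathrm{Re}(\mu)\ne0$: any $\theta^+\in(0,\pi)$, $\theta^-\in(-\pi,0)$ with $\mathrm{Re}(\mu s)>0$ on $\arg s=\theta^\pm$. (vi) $N=\alpha=p-q=\mu=0$, $\mathrm{Re}(\nu)<0$: $\theta^\pm=\pm\pi/2$. (vii) $N=\alpha=p-q=\mu=\nu=0$, with $z\in(0,1)\cup(1,\infty)$: $\theta^\pm=\pm\epsilon$ if $z>1$ and $\theta^\pm=\pm(\pi-\epsilon)$ if $0<z<1$, for any $\epsilon\in(0,\pi/2)$. Parameters satisfying $\Lambda^+\cap\Lambda^-=\emptyset$ and one of (i)-(vii) are called admissible. In cases (i)-(v) $K$ is defined by the same integral for all $z$ on the Riemann surface of the logarithm, with $z^{-s}=e^{-s\ln z}$; $C_2z^{\omega_1}$ in the claim is the point with logarithm $\frac{q-p}2\ln(2\pi)+\frac{N(\omega_1+\omega_2)/2-\mu}{\omega_2}\ln\omega_2+\omega_1\ln z$ (here with the original parameters). $\tilde K$-function. For $z>0$, $$\tilde K_{p,q}^{m,n}\Big(\begin{matrix} {\bf a} \\ {\bf b} \end{matrix}\Big\vert z;\boldsymbol\omega,\alpha\Big)=\frac1{2\pi i}\int_{\tilde\gamma}\frac{\prod_{j=1}^m\Gamma_2(b_j-s;\boldsymbol\omega)\prod_{j=1}^n\Gamma_2(\omega_1+\omega_2-a_j+s;\boldsymbol\omega)}{\prod_{j=m+1}^q\Gamma_2(\omega_1+\omega_2-b_j+s;\boldsymbol\omega)\prod_{j=n+1}^p\Gamma_2(a_j-s;\boldsymbol\omega)}e^{\frac{\pi\alpha}{\omega_1\omega_2}s^2}z^{-s}\,ds,$$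 where $\tilde\gamma=\omega_1\gamma$ and $\gamma=\mathcal L_{\theta^-,\theta^+}$ is a contour as in the definition of the $K$-function, with angles $\theta^\pm$ given by whichever of the cases (i)-(vii) applies to $K_{q,p}^{p-n,q-m}\Big(\begin{matrix} \tilde{\bf a} \\ \tilde{\bf b} \end{matrix}\Big\vert C_2z^{\omega_1};\tau,\eta\Big)$, that is, to the $K$-function on the right-hand side of the claim (upper parameters $\tilde{\bf a}\in\mathbb C^q$, lower parameters $\tilde{\bf b}\in\mathbb C^p$, indices $p-n,q-m$, and $\tau,\eta$). *)

theory Defs
  imports "HOL-Analysis.Analysis"
begin

section \<open>Double gamma functions\<close>

text \<open>The logarithm of \<open>Gamma (k \<tau>)\<close> is the branch \<open>ln_Gamma\<close>, which is analytic off the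
  nonpositive real axis and real on the positive one.\<close>

definition barnes_C :: "complex \<Rightarrow> complex" where
  "barnes_C \<tau> = lim (\<lambda>k::nat. (\<Sum>j\<in>{1..<k}. Digamma (of_nat j * \<tau>))
     + 1/2 * Digamma (of_nat k * \<tau>)
     - 1/\<tau> * (ln_Gamma (of_nat k * \<tau>) - of_real (ln (sqrt (2*pi)))))"

definition barnes_D :: "complex \<Rightarrow> complex" where
  "barnes_D \<tau> = lim (\<lambda>k::nat. (\<Sum>j\<in>{1..<k}. Polygamma 1 (of_nat j * \<tau>))
     + 1/2 * Polygamma 1 (of_nat k * \<tau>)
     - 1/\<tau> * Digamma (of_nat k * \<tau>))"

definition barnes_a :: "complex \<Rightarrow> complex" where
  "barnes_a \<tau> = euler_mascheroni * \<tau> + \<tau>/2 * ln (2 * of_real pi * \<tau>) + 1/2 * ln \<tau> - \<tau> * barnes_C \<tau>"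

definition barnes_b :: "complex \<Rightarrow> complex" where
  "barnes_b \<tau> = - ((of_real pi)^2 * \<tau>^2 / 6) - \<tau> * ln \<tau> - \<tau>^2 * barnes_D \<tau>"

text \<open>The double product converges unconditionally; it is the limit of the finite partial
  products along the filter that also underlies \<open>infsum\<close>.\<close>

definition barnes_G :: "complex \<Rightarrow> complex \<Rightarrow> complex" where
  "barnes_G z \<tau> = z/\<tau> * exp (barnes_a \<tau> * (z/\<tau>) + barnes_b \<tau> * (z^2 / (2*\<tau>^2))) *
     Lim (finite_subsets_at_top (UNIV - {(0::nat, 0::nat)}))
       (\<lambda>F. \<Prod>(k,l)\<in>F. (1 + z / (of_nat k * \<tau> + of_nat l)) *
          exp (- z / (of_nat k * \<tau> + of_nat l) + z^2 / (2 * (of_nat k * \<tau> + of_nat l)^2)))"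

definition Gamma2 :: "real \<Rightarrow> real \<Rightarrow> complex \<Rightarrow> complex" where
  "Gamma2 \<omega>\<^sub>1 \<omega>\<^sub>2 z =
     of_real (2*pi) powr (z / (2 * of_real \<omega>\<^sub>1)) *
     of_real \<omega>\<^sub>2 powr (- (z^2 / (2 * of_real \<omega>\<^sub>1 * of_real \<omega>\<^sub>2))
        + z * (of_real \<omega>\<^sub>1 + of_real \<omega>\<^sub>2) / (2 * of_real \<omega>\<^sub>1 * of_real \<omega>\<^sub>2) - 1) *
     inverse (barnes_G (z / of_real \<omega>\<^sub>1) (of_real (\<omega>\<^sub>2 / \<omega>\<^sub>1)))"


section \<open>Parameters\<close>

text \<open>Parameter vectors \<open>a \<in> \<complex>\<^sup>p\<close> and \<open>b \<in> \<complex>\<^sup>q\<close> are functions on \<open>nat\<close> of which only the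
  values at \<open>1..p\<close> and \<open>1..q\<close> are ever used.\<close>

definition K_N :: "nat \<Rightarrow> nat \<Rightarrow> nat \<Rightarrow> nat \<Rightarrow> int" where
  "K_N m n p q = 2 * (int m + int n) - int p - int q"

definition K_nu :: "nat \<Rightarrow> nat \<Rightarrow> (nat \<Rightarrow> complex) \<Rightarrow> (nat \<Rightarrow> complex) \<Rightarrow> complex" where
  "K_nu p q a b = (\<Sum>j=1..p. a j) - (\<Sum>j=1..q. b j)"

definition K_mu :: "nat \<Rightarrow> nat \<Rightarrow> nat \<Rightarrow> nat \<Rightarrow> (nat \<Rightarrow> complex) \<Rightarrow> (nat \<Rightarrow> complex) \<Rightarrow> complex" where
  "K_mu m n p q a b =
     (\<Sum>j=1..n. a j) - (\<Sum>j=n+1..p. a j) + (\<Sum>j=1..m. b j) - (\<Sum>j=m+1..q. b j)"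

definition K_xi :: "nat \<Rightarrow> nat \<Rightarrow> nat \<Rightarrow> nat \<Rightarrow> (nat \<Rightarrow> complex) \<Rightarrow> (nat \<Rightarrow> complex) \<Rightarrow> complex" where
  "K_xi m n p q a b =
     (\<Sum>j=1..n. (a j)^2) - (\<Sum>j=n+1..p. (a j)^2) + (\<Sum>j=1..m. (b j)^2) - (\<Sum>j=m+1..q. (b j)^2)"

definition Lambda_plus :: "nat \<Rightarrow> nat \<Rightarrow> (nat \<Rightarrow> complex) \<Rightarrow> real \<Rightarrow> complex set" where
  "Lambda_plus n p a \<tau> = {a j + of_nat l * of_real \<tau> + of_nat k | j l k. n + 1 \<le> j \<and> j \<le> p}"

definition Lambda_minus :: "nat \<Rightarrow> nat \<Rightarrow> (nat \<Rightarrow> complex) \<Rightarrow> real \<Rightarrow> complex set" where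
  "Lambda_minus m q b \<tau> =
     {b j - of_nat l * of_real \<tau> - of_nat k | j l k. m + 1 \<le> j \<and> j \<le> q \<and> 1 \<le> l \<and> 1 \<le> k}"

definition K_case_i :: "nat \<Rightarrow> nat \<Rightarrow> nat \<Rightarrow> nat \<Rightarrow> bool" where
  "K_case_i m n p q \<longleftrightarrow> K_N m n p q > 0"

definition K_case_ii :: "nat \<Rightarrow> nat \<Rightarrow> nat \<Rightarrow> nat \<Rightarrow> complex \<Rightarrow> bool" where
  "K_case_ii m n p q \<alpha> \<longleftrightarrow> K_N m n p q = 0 \<and> Re \<alpha> \<ge> 0 \<and>
     4 * \<alpha> \<noteq> (of_nat p - of_nat q) * \<i> \<and> 4 * \<alpha> \<noteq> - ((of_nat p - of_nat q) * \<i>)"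

definition K_case_iii where
  "K_case_iii m n p q a b \<alpha> \<longleftrightarrow> K_N m n p q = 0 \<and>
     4 * \<alpha> = (of_nat q - of_nat p) * \<i> \<and> 4 * \<alpha> \<noteq> 0 \<and>
     K_mu m n p q a b \<noteq> 0 \<and> Arg (K_mu m n p q a b) \<noteq> pi/2"

definition K_case_iv where
  "K_case_iv m n p q a b \<alpha> \<longleftrightarrow> K_N m n p q = 0 \<and>
     4 * \<alpha> = (of_nat p - of_nat q) * \<i> \<and> 4 * \<alpha> \<noteq> 0 \<and>
     K_mu m n p q a b \<noteq> 0 \<and> Arg (K_mu m n p q a b) \<noteq> - pi/2"

definition K_case_v where
  "K_case_v m n p q a b (\<alpha>::complex) \<longleftrightarrow> K_N m n p q = 0 \<and> \<alpha> = 0 \<and> p = q \<and>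
     Re (K_mu m n p q a b) \<noteq> 0"

definition K_case_vi where
  "K_case_vi m n p q a b (\<alpha>::complex) \<longleftrightarrow> K_N m n p q = 0 \<and> \<alpha> = 0 \<and> p = q \<and>
     K_mu m n p q a b = 0 \<and> Re (K_nu p q a b) < 0"

definition K_case_vii where
  "K_case_vii m n p q a b (\<alpha>::complex) \<longleftrightarrow> K_N m n p q = 0 \<and> \<alpha> = 0 \<and> p = q \<and>
     K_mu m n p q a b = 0 \<and> K_nu p q a b = 0"

definition K_admissible :: "nat \<Rightarrow> nat \<Rightarrow> nat \<Rightarrow> nat \<Rightarrow>
    (nat \<Rightarrow> complex) \<Rightarrow> (nat \<Rightarrow> complex) \<Rightarrow> real \<Rightarrow> complex \<Rightarrow> bool" where
  "K_admissible m n p q a b \<tau> \<alpha> \<longleftrightarrow>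
     Lambda_plus n p a \<tau> \<inter> Lambda_minus m q b \<tau> = {} \<and>
     (K_case_i m n p q \<or> K_case_ii m n p q \<alpha> \<or> K_case_iii m n p q a b \<alpha> \<or>
      K_case_iv m n p q a b \<alpha> \<or> K_case_v m n p q a b \<alpha> \<or> K_case_vi m n p q a b \<alpha> \<or>
      K_case_vii m n p q a b \<alpha>)"


section \<open>Contours\<close>

text \<open>A point of the Riemann surface of the logarithm is represented by its logarithm \<open>L\<close>, so
  that \<open>z\<close> to the power \<open>-s\<close> is \<open>exp (- s * L)\<close>. Positive \<open>z\<close> correspond to real \<open>L\<close>, and
  \<open>z > 1\<close>, \<open>z < 1\<close> to \<open>L > 0\<close>, \<open>L < 0\<close>. The points with argument \<open>\<theta>\<close> are \<open>rcis r \<theta>\<close> with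
  \<open>r > 0\<close>.\<close>

definition K_angles :: "nat \<Rightarrow> nat \<Rightarrow> nat \<Rightarrow> nat \<Rightarrow> (nat \<Rightarrow> complex) \<Rightarrow> (nat \<Rightarrow> complex) \<Rightarrow>
    complex \<Rightarrow> complex \<Rightarrow> real \<Rightarrow> real \<Rightarrow> bool" where
  "K_angles m n p q a b \<alpha> L \<theta>m \<theta>p \<longleftrightarrow>
     0 < \<theta>p \<and> \<theta>p < pi \<and> - pi < \<theta>m \<and> \<theta>m < 0 \<and>
     ((K_case_i m n p q \<and> pi/4 < \<theta>p \<and> \<theta>p < 3*pi/4 \<and> - 3*pi/4 < \<theta>m \<and> \<theta>m < - pi/4) \<or>
      (K_case_ii m n p q \<alpha> \<and>
         (\<forall>r>0. Re ((\<alpha> + (of_nat p - of_nat q) * \<i> / 4) * (rcis r \<theta>p)^2) < 0) \<and>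
         (\<forall>r>0. Re ((\<alpha> - (of_nat p - of_nat q) * \<i> / 4) * (rcis r \<theta>m)^2) < 0)) \<or>
      (K_case_iii m n p q a b \<alpha> \<and>
         (\<forall>r>0. Re (K_mu m n p q a b * rcis r \<theta>p) > 0) \<and>
         (\<forall>r>0. Re (\<i> * (of_nat q - of_nat p) * (rcis r \<theta>m)^2) < 0)) \<or>
      (K_case_iv m n p q a b \<alpha> \<and>
         (\<forall>r>0. Re (\<i> * (of_nat p - of_nat q) * (rcis r \<theta>p)^2) < 0) \<and>
         (\<forall>r>0. Re (K_mu m n p q a b * rcis r \<theta>m) > 0)) \<or>
      (K_case_v m n p q a b \<alpha> \<and>
         (\<forall>r>0. Re (K_mu m n p q a b * rcis r \<theta>p) > 0) \<and>
         (\<forall>r>0. Re (K_mu m n p q a b * rcis r \<theta>m) > 0)) \<or>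
      (K_case_vi m n p q a b \<alpha> \<and> \<theta>p = pi/2 \<and> \<theta>m = - pi/2) \<or>
      (K_case_vii m n p q a b \<alpha> \<and> Im L = 0 \<and>
         (\<exists>\<epsilon>. 0 < \<epsilon> \<and> \<epsilon> < pi/2 \<and>
            ((Re L > 0 \<and> \<theta>p = \<epsilon> \<and> \<theta>m = - \<epsilon>) \<or>
             (Re L < 0 \<and> \<theta>p = pi - \<epsilon> \<and> \<theta>m = - (pi - \<epsilon>))))))"

text \<open>Contours are parametrised by the real line, coming in along the ray in the lower half-plane
  and going out along the ray in the upper one. The domain \<open>V\<close>, which does not contain the large
  positive numbers, then lies to the left, as the orientation requires.\<close>

definition separating_contours ::
    "complex set \<Rightarrow> complex set \<Rightarrow> real \<Rightarrow> real \<Rightarrow> (real \<Rightarrow> complex) set" where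
  "separating_contours Lp Lm \<theta>m \<theta>p = {\<gamma>. inj \<gamma> \<and>
     (\<forall>R. \<gamma> piecewise_C1_differentiable_on {-R..R}) \<and>
     (\<exists>R cp cm. (\<forall>t\<ge>R. \<gamma> t = cp + of_real t * cis \<theta>p) \<and>
                (\<forall>t\<ge>R. \<gamma> (- t) = cm + of_real t * cis \<theta>m)) \<and>
     (\<exists>U V. open U \<and> connected U \<and> open V \<and> connected V \<and> V \<noteq> {} \<and>
            U \<inter> V = {} \<and> U \<union> V = - range \<gamma> \<and>
            Lp \<subseteq> U \<and> (\<forall>\<^sub>F x in at_top. complex_of_real x \<in> U) \<and> Lm \<subseteq> V)}"

definition K_contours :: "nat \<Rightarrow> nat \<Rightarrow> nat \<Rightarrow> nat \<Rightarrow> (nat \<Rightarrow> complex) \<Rightarrow> (nat \<Rightarrow> complex) \<Rightarrow>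
    real \<Rightarrow> complex \<Rightarrow> complex \<Rightarrow> (real \<Rightarrow> complex) set" where
  "K_contours m n p q a b \<tau> \<alpha> L = {\<gamma>. \<exists>\<theta>m \<theta>p. K_angles m n p q a b \<alpha> L \<theta>m \<theta>p \<and>
     \<gamma> \<in> separating_contours (Lambda_plus n p a \<tau>) (Lambda_minus m q b \<tau>) \<theta>m \<theta>p}"

definition has_line_integral :: "(complex \<Rightarrow> complex) \<Rightarrow> complex \<Rightarrow> (real \<Rightarrow> complex) \<Rightarrow> bool" where
  "has_line_integral f I \<gamma> \<longleftrightarrow>
     ((\<lambda>t. f (\<gamma> t) * vector_derivative \<gamma> (at t)) has_integral I) UNIV"

text \<open>The common value of the integrals of \<open>f\<close> over all contours of a class, and \<open>0\<close> (as for
  nonexistent integrals) if there is no such value.\<close>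

definition common_line_integral :: "(real \<Rightarrow> complex) set \<Rightarrow> (complex \<Rightarrow> complex) \<Rightarrow> complex" where
  "common_line_integral \<Gamma> f =
     (if \<exists>!I. \<forall>\<gamma>\<in>\<Gamma>. has_line_integral f I \<gamma>
      then THE I. \<forall>\<gamma>\<in>\<Gamma>. has_line_integral f I \<gamma> else 0)"


section \<open>The \<open>K\<close>-functions\<close>

definition K_integrand :: "nat \<Rightarrow> nat \<Rightarrow> nat \<Rightarrow> nat \<Rightarrow> (nat \<Rightarrow> complex) \<Rightarrow> (nat \<Rightarrow> complex) \<Rightarrow>
    real \<Rightarrow> complex \<Rightarrow> complex" where
  "K_integrand m n p q a b \<tau> s =
     (\<Prod>j=1..m. barnes_G (b j - s) (of_real \<tau>)) *
     (\<Prod>j=1..n. barnes_G (1 + of_real \<tau> - a j + s) (of_real \<tau>)) /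
     ((\<Prod>j=m+1..q. barnes_G (1 + of_real \<tau> - b j + s) (of_real \<tau>)) *
      (\<Prod>j=n+1..p. barnes_G (a j - s) (of_real \<tau>)))"

text \<open>The last argument is the logarithm of the point at which \<open>K\<close> is evaluated.\<close>

definition K_fun :: "nat \<Rightarrow> nat \<Rightarrow> nat \<Rightarrow> nat \<Rightarrow> (nat \<Rightarrow> complex) \<Rightarrow> (nat \<Rightarrow> complex) \<Rightarrow>
    real \<Rightarrow> complex \<Rightarrow> complex \<Rightarrow> complex" where
  "K_fun m n p q a b \<tau> \<alpha> L = 1 / (2 * of_real pi * \<i>) *
     common_line_integral (K_contours m n p q a b \<tau> \<alpha> L)
       (\<lambda>s. K_integrand m n p q a b \<tau> s * exp (of_real pi * \<alpha> / of_real \<tau> * s^2) * exp (- s * L))"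

definition Kt_integrand :: "nat \<Rightarrow> nat \<Rightarrow> nat \<Rightarrow> nat \<Rightarrow> (nat \<Rightarrow> complex) \<Rightarrow> (nat \<Rightarrow> complex) \<Rightarrow>
    real \<Rightarrow> real \<Rightarrow> complex \<Rightarrow> complex" where
  "Kt_integrand m n p q a b \<omega>\<^sub>1 \<omega>\<^sub>2 s =
     (\<Prod>j=1..m. Gamma2 \<omega>\<^sub>1 \<omega>\<^sub>2 (b j - s)) *
     (\<Prod>j=1..n. Gamma2 \<omega>\<^sub>1 \<omega>\<^sub>2 (of_real \<omega>\<^sub>1 + of_real \<omega>\<^sub>2 - a j + s)) /
     ((\<Prod>j=m+1..q. Gamma2 \<omega>\<^sub>1 \<omega>\<^sub>2 (of_real \<omega>\<^sub>1 + of_real \<omega>\<^sub>2 - b j + s)) *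
      (\<Prod>j=n+1..p. Gamma2 \<omega>\<^sub>1 \<omega>\<^sub>2 (a j - s)))"

text \<open>The parameter vector \<open>(c\<^sub>r / \<omega>, \<dots>, c\<^sub>1 / \<omega>)\<close>.\<close>

definition reversed_scaled :: "nat \<Rightarrow> real \<Rightarrow> (nat \<Rightarrow> complex) \<Rightarrow> nat \<Rightarrow> complex" where
  "reversed_scaled r \<omega> c = (\<lambda>j. c (r - j + 1) / of_real \<omega>)"

definition K_eta :: "nat \<Rightarrow> nat \<Rightarrow> nat \<Rightarrow> nat \<Rightarrow> real \<Rightarrow> complex \<Rightarrow> complex" where
  "K_eta m n p q \<omega>\<^sub>2 \<alpha> = \<alpha> - of_real (real_of_int (K_N m n p q) * ln \<omega>\<^sub>2 / (2*pi))"

definition K_C1 :: "nat \<Rightarrow> nat \<Rightarrow> nat \<Rightarrow> nat \<Rightarrow> (nat \<Rightarrow> complex) \<Rightarrow> (nat \<Rightarrow> complex) \<Rightarrow>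
    real \<Rightarrow> real \<Rightarrow> complex" where
  "K_C1 m n p q a b \<omega>\<^sub>1 \<omega>\<^sub>2 =
     of_real (2*pi) powr (((of_real \<omega>\<^sub>1 + of_real \<omega>\<^sub>2) * (of_nat m + of_nat n - of_nat q)
        - K_nu p q a b) / (2 * of_real \<omega>\<^sub>1)) *
     of_real \<omega>\<^sub>2 powr (- of_int (K_N m n p q)
        - K_xi m n p q a b / (2 * of_real \<omega>\<^sub>1 * of_real \<omega>\<^sub>2)
        + K_mu m n p q a b * (of_real \<omega>\<^sub>1 + of_real \<omega>\<^sub>2) / (2 * of_real \<omega>\<^sub>1 * of_real \<omega>\<^sub>2)) *
     of_real \<omega>\<^sub>1"

text \<open>The logarithm that fixes \<open>C\<^sub>2\<close> as a point of the Riemann surface of the logarithm.\<close>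

definition K_ln_C2 :: "nat \<Rightarrow> nat \<Rightarrow> nat \<Rightarrow> nat \<Rightarrow> (nat \<Rightarrow> complex) \<Rightarrow> (nat \<Rightarrow> complex) \<Rightarrow>
    real \<Rightarrow> real \<Rightarrow> complex" where
  "K_ln_C2 m n p q a b \<omega>\<^sub>1 \<omega>\<^sub>2 =
     (of_nat q - of_nat p) / 2 * of_real (ln (2*pi)) +
     (of_int (K_N m n p q) * (of_real \<omega>\<^sub>1 + of_real \<omega>\<^sub>2) / 2 - K_mu m n p q a b) / of_real \<omega>\<^sub>2
       * of_real (ln \<omega>\<^sub>2)"

lemma exp_K_ln_C2:
  assumes "\<omega>\<^sub>2 > 0"
  shows "exp (K_ln_C2 m n p q a b \<omega>\<^sub>1 \<omega>\<^sub>2) =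
     of_real (2*pi) powr ((of_nat q - of_nat p) / 2) *
     of_real \<omega>\<^sub>2 powr ((of_int (K_N m n p q) * (of_real \<omega>\<^sub>1 + of_real \<omega>\<^sub>2) / 2
        - K_mu m n p q a b) / of_real \<omega>\<^sub>2)"
proof -
  have "ln (complex_of_real (2*pi)) = of_real (ln (2*pi))"
    by (rule Ln_of_real) simp
  moreover have "ln (complex_of_real \<omega>\<^sub>2) = of_real (ln \<omega>\<^sub>2)"
    using assms by (rule Ln_of_real)
  moreover have "complex_of_real (2*pi) \<noteq> 0" "complex_of_real \<omega>\<^sub>2 \<noteq> 0"
    using assms by auto
  ultimately show ?thesis
    by (simp only: K_ln_C2_def exp_add powr_def if_False)
qed

definition Kt_fun :: "nat \<Rightarrow> nat \<Rightarrow> nat \<Rightarrow> nat \<Rightarrow> (nat \<Rightarrow> complex) \<Rightarrow> (nat \<Rightarrow> complex) \<Rightarrow>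
    real \<Rightarrow> real \<Rightarrow> complex \<Rightarrow> real \<Rightarrow> complex" where
  "Kt_fun m n p q a b \<omega>\<^sub>1 \<omega>\<^sub>2 \<alpha> z = 1 / (2 * of_real pi * \<i>) *
     common_line_integral
       {\<lambda>t. of_real \<omega>\<^sub>1 * \<gamma> t | \<gamma>.
          \<gamma> \<in> K_contours (p - n) (q - m) q p (reversed_scaled q \<omega>\<^sub>1 b) (reversed_scaled p \<omega>\<^sub>1 a)
                (\<omega>\<^sub>2 / \<omega>\<^sub>1) (K_eta m n p q \<omega>\<^sub>2 \<alpha>)
                (K_ln_C2 m n p q a b \<omega>\<^sub>1 \<omega>\<^sub>2 + of_real (\<omega>\<^sub>1 * ln z))}
       (\<lambda>s. Kt_integrand m n p q a b \<omega>\<^sub>1 \<omega>\<^sub>2 s *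
            exp (of_real pi * \<alpha> / (of_real \<omega>\<^sub>1 * of_real \<omega>\<^sub>2) * s^2) * of_real z powr (- s))"

end

(*
  Up to the exponential of a quadratic polynomial, Gamma2 (c - \<omega>\<^sub>1 s) is the reciprocal of
  G (c / \<omega>\<^sub>1 - s). Hence the substitution s \<mapsto> \<omega>\<^sub>1 s turns the integrand of the \<open>K\<close>-tilde
  function into that of the \<open>K\<close>-function with numerator and denominator exchanged, times the
  exponential of a quadratic polynomial in s. Its constant term gives C\<^sub>1, its linear term C\<^sub>2
  and its quadratic term the passage from \<alpha> to \<eta>.
*)
theory Submission
  imports Defs
begin

section \<open>Reversed parameter vectors\<close>

lemma prod_nat_reflect_lower:
  fixes g :: "nat \<Rightarrow> 'a::comm_monoid_mult"
  assumes "k \<le> r"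
  shows "(\<Prod>j=1..r-k. g (r - j + 1)) = (\<Prod>j=k+1..r. g j)"
  by (rule prod.reindex_bij_witness[where i = "\<lambda>j. r - j + 1" and j = "\<lambda>j. r - j + 1"])
     (use assms in auto)

lemma prod_nat_reflect_upper:
  fixes g :: "nat \<Rightarrow> 'a::comm_monoid_mult"
  assumes "k \<le> r"
  shows "(\<Prod>j=r-k+1..r. g (r - j + 1)) = (\<Prod>j=1..k. g j)"
  by (rule prod.reindex_bij_witness[where i = "\<lambda>j. r - j + 1" and j = "\<lambda>j. r - j + 1"])
     (use assms in auto)

text \<open>Reversal brings the last \<open>q - m\<close> entries of \<open>b\<close> and the last
  \<open>p - n\<close> entries of \<open>a\<close>, which sit in the denominator of the
  \<open>K\<close>-tilde integrand, to the front. There \<open>K_integrand\<close> with first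
  indices \<open>p - n\<close> and \<open>q - m\<close> takes its numerator.\<close>

lemma K_integrand_reversed_scaled:
  assumes "m \<le> q" "n \<le> p"
  shows "K_integrand (p - n) (q - m) q p (reversed_scaled q \<omega> b) (reversed_scaled p \<omega> a) \<tau> s =
     (\<Prod>j=n+1..p. barnes_G (a j / of_real \<omega> - s) (of_real \<tau>)) *
     (\<Prod>j=m+1..q. barnes_G (1 + of_real \<tau> - b j / of_real \<omega> + s) (of_real \<tau>)) /
     ((\<Prod>j=1..n. barnes_G (1 + of_real \<tau> - a j / of_real \<omega> + s) (of_real \<tau>)) *
      (\<Prod>j=1..m. barnes_G (b j / of_real \<omega> - s) (of_real \<tau>)))"
  unfolding K_integrand_def reversed_scaled_def
    prod_nat_reflect_lower[OF assms(1), of "\<lambda>i. barnes_G (1 + of_real \<tau> - b i / of_real \<omega> + s) (of_real \<tau>)"]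
    prod_nat_reflect_lower[OF assms(2), of "\<lambda>i. barnes_G (a i / of_real \<omega> - s) (of_real \<tau>)"]
    prod_nat_reflect_upper[OF assms(1), of "\<lambda>i. barnes_G (b i / of_real \<omega> - s) (of_real \<tau>)"]
    prod_nat_reflect_upper[OF assms(2), of "\<lambda>i. barnes_G (1 + of_real \<tau> - a i / of_real \<omega> + s) (of_real \<tau>)"]
  ..

section \<open>The exponential factor of the symmetric double gamma function\<close>

text \<open>A logarithm of the elementary factor in \<open>Gamma2\<close>, not of
  \<open>Gamma2\<close> itself. Both bases are positive, so their complex powers merge into one
  exponential with real logarithms, and products over parameters become sums of exponents.\<close>

definition Gamma2_exponent :: "real \<Rightarrow> real \<Rightarrow> complex \<Rightarrow> complex" where
  "Gamma2_exponent \<omega>\<^sub>1 \<omega>\<^sub>2 z =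
     z / (2 * of_real \<omega>\<^sub>1) * of_real (ln (2*pi)) +
     (- (z^2 / (2 * of_real \<omega>\<^sub>1 * of_real \<omega>\<^sub>2))
        + z * (of_real \<omega>\<^sub>1 + of_real \<omega>\<^sub>2) / (2 * of_real \<omega>\<^sub>1 * of_real \<omega>\<^sub>2) - 1) * of_real (ln \<omega>\<^sub>2)"

lemma powr_of_real_pos:
  assumes "x > 0"
  shows "complex_of_real x powr w = exp (w * of_real (ln x))"
  using assms by (simp add: powr_def Ln_of_real)

lemma Gamma2_eq_exp:
  assumes "\<omega>\<^sub>2 > 0"
  shows "Gamma2 \<omega>\<^sub>1 \<omega>\<^sub>2 z = exp (Gamma2_exponent \<omega>\<^sub>1 \<omega>\<^sub>2 z) *
    inverse (barnes_G (z / of_real \<omega>\<^sub>1) (of_real (\<omega>\<^sub>2 / \<omega>\<^sub>1)))"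
proof -
  have "(0::real) < 2 * pi"
    by simp
  then show ?thesis
    unfolding Gamma2_def Gamma2_exponent_def
    by (simp only: powr_of_real_pos[OF assms] powr_of_real_pos[of "2 * pi"] exp_add)
qed

lemma prod_Gamma2:
  assumes "\<omega>\<^sub>2 > 0" "finite A"
  shows "(\<Prod>j\<in>A. Gamma2 \<omega>\<^sub>1 \<omega>\<^sub>2 (f j)) = exp (\<Sum>j\<in>A. Gamma2_exponent \<omega>\<^sub>1 \<omega>\<^sub>2 (f j)) /
    (\<Prod>j\<in>A. barnes_G (f j / of_real \<omega>\<^sub>1) (of_real (\<omega>\<^sub>2 / \<omega>\<^sub>1)))"
  using assms by (simp add: Gamma2_eq_exp prod.distrib exp_sum prod_inversef[unfolded comp_def] divide_inverse)

text \<open>For \<open>c\<close> one of the parameter vectors, the cardinality and the two power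
  sums are the pieces from which \<open>N\<close>, \<mu>, \<nu> and \<xi> are assembled.\<close>

lemma sum_quadratic:
  fixes c :: "'i \<Rightarrow> complex"
  shows "(\<Sum>j\<in>A. u + v * c j + w * (c j)^2) =
    of_nat (card A) * u + v * (\<Sum>j\<in>A. c j) + w * (\<Sum>j\<in>A. (c j)^2)"
  by (simp add: sum.distrib sum_distrib_left)

text \<open>The exponents are sorted by powers of the parameter \<open>c\<close>, not of
  \<open>s\<close>, so that \<open>sum_quadratic\<close> applies. The second argument is
  \<open>w1 + w2\<close> minus the first, and the coefficient of \<open>l\<close> in the exponent,
  \<open>z * (w1 + w2 - z) / (2 * w1 * w2) - 1\<close>, is invariant under this reflection. Hence
  the two expansions differ only in the terms with \<open>t\<close>.\<close>

lemma Gamma2_exponent_diff: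
  assumes "\<omega>\<^sub>1 > 0" "\<omega>\<^sub>2 > 0"
  defines "w1 \<equiv> complex_of_real \<omega>\<^sub>1" and "w2 \<equiv> complex_of_real \<omega>\<^sub>2"
    and "l \<equiv> complex_of_real (ln \<omega>\<^sub>2)" and "t \<equiv> complex_of_real (ln (2*pi))"
  shows "Gamma2_exponent \<omega>\<^sub>1 \<omega>\<^sub>2 (c - w1 * s) =
      (- (s * t / 2) - (w1 * s^2 + (w1 + w2) * s) * l / (2 * w2) - l) +
      (t / (2 * w1) + (2 * w1 * s + w1 + w2) * l / (2 * w1 * w2)) * c + (- l / (2 * w1 * w2)) * c^2"
    and "Gamma2_exponent \<omega>\<^sub>1 \<omega>\<^sub>2 (w1 + w2 - c + w1 * s) =
      ((w1 + w2 + w1 * s) * t / (2 * w1) - (w1 * s^2 + (w1 + w2) * s) * l / (2 * w2) - l) +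
      (- t / (2 * w1) + (2 * w1 * s + w1 + w2) * l / (2 * w1 * w2)) * c + (- l / (2 * w1 * w2)) * c^2"
proof -
  have nz: "w1 \<noteq> 0" "w2 \<noteq> 0"
    using assms by auto
  show "Gamma2_exponent \<omega>\<^sub>1 \<omega>\<^sub>2 (c - w1 * s) =
      (- (s * t / 2) - (w1 * s^2 + (w1 + w2) * s) * l / (2 * w2) - l) +
      (t / (2 * w1) + (2 * w1 * s + w1 + w2) * l / (2 * w1 * w2)) * c + (- l / (2 * w1 * w2)) * c^2"
    using nz unfolding Gamma2_exponent_def w1_def[symmetric] w2_def[symmetric] l_def[symmetric] t_def[symmetric]
    by (simp add: divide_simps) (simp add: algebra_simps power2_eq_square)
  show "Gamma2_exponent \<omega>\<^sub>1 \<omega>\<^sub>2 (w1 + w2 - c + w1 * s) =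
      ((w1 + w2 + w1 * s) * t / (2 * w1) - (w1 * s^2 + (w1 + w2) * s) * l / (2 * w2) - l) +
      (- t / (2 * w1) + (2 * w1 * s + w1 + w2) * l / (2 * w1 * w2)) * c + (- l / (2 * w1 * w2)) * c^2"
    using nz unfolding Gamma2_exponent_def w1_def[symmetric] w2_def[symmetric] l_def[symmetric] t_def[symmetric]
    by (simp add: divide_simps) (simp add: algebra_simps power2_eq_square)
qed

text \<open>The terms with \<open>l\<close> are common to both kinds of factor, so the four blocks
  keep the signs of numerator and denominator, which yields \<open>N\<close>, \<mu> and \<xi>. The
  term \<open>c * t / (2 * w1)\<close> changes sign between the two kinds, so every
  \<open>b j\<close> is counted positively and every \<open>a j\<close> negatively, which yields
  minus \<nu>.\<close>

lemma Gamma2_exponent_total: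
  assumes "\<omega>\<^sub>1 > 0" "\<omega>\<^sub>2 > 0" "m \<le> q" "n \<le> p"
  defines "w1 \<equiv> complex_of_real \<omega>\<^sub>1" and "w2 \<equiv> complex_of_real \<omega>\<^sub>2"
    and "l \<equiv> complex_of_real (ln \<omega>\<^sub>2)" and "t \<equiv> complex_of_real (ln (2*pi))"
    and "N \<equiv> (of_int (K_N m n p q) :: complex)"
  shows "(\<Sum>j=1..m. Gamma2_exponent \<omega>\<^sub>1 \<omega>\<^sub>2 (b j - w1 * s))
       + (\<Sum>j=1..n. Gamma2_exponent \<omega>\<^sub>1 \<omega>\<^sub>2 (w1 + w2 - a j + w1 * s))
       - ((\<Sum>j=m+1..q. Gamma2_exponent \<omega>\<^sub>1 \<omega>\<^sub>2 (w1 + w2 - b j + w1 * s))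
       + (\<Sum>j=n+1..p. Gamma2_exponent \<omega>\<^sub>1 \<omega>\<^sub>2 (a j - w1 * s)))
     = ((w1 + w2) * (of_nat m + of_nat n - of_nat q) - K_nu p q a b) / (2 * w1) * t
       + (- N - K_xi m n p q a b / (2 * w1 * w2) + K_mu m n p q a b * (w1 + w2) / (2 * w1 * w2)) * l
       - s * K_ln_C2 m n p q a b \<omega>\<^sub>1 \<omega>\<^sub>2 - N * w1 * l / (2 * w2) * s^2"
proof -
  have nz: "w1 \<noteq> 0" "w2 \<noteq> 0"
    using assms by auto
  \<comment> \<open>Only \<nu> sums over whole ranges. Cutting these at \<open>m\<close> and
    \<open>n\<close> leaves the block sums of \<mu> and \<xi> as the only atoms of the final ring
    identity.\<close>
  have split: "sum f {1..r} = sum f {1..k} + sum f {k+1..r}" if "k \<le> r"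
    for f :: "nat \<Rightarrow> complex" and k r
    using sum.ub_add_nat[of 1 k f "r - k"] that by simp
  have N: "N = 2 * (of_nat m + of_nat n) - of_nat p - of_nat q"
    by (simp add: N_def K_N_def)
  have card: "(of_nat (card {m+1..q}) :: complex) = of_nat q - of_nat m"
    "(of_nat (card {n+1..p}) :: complex) = of_nat p - of_nat n"
    using assms by (simp_all add: of_nat_diff)
  show ?thesis
    unfolding Gamma2_exponent_diff[OF assms(1,2), folded w1_def w2_def l_def t_def] sum_quadratic card
      K_ln_C2_def K_nu_def K_mu_def K_xi_def
      split[OF assms(3)] split[OF assms(4)] N_def[symmetric] w1_def[symmetric] w2_def[symmetric]
      l_def[symmetric] t_def[symmetric] N
    using nz by (simp add: divide_simps) (simp add: algebra_simps power2_eq_square)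
qed

section \<open>The integrands under the substitution\<close>

text \<open>The last factor \<open>of_real \<omega>\<^sub>1\<close> on the left is the derivative of
  the substitution; it becomes the factor \<open>\<omega>\<^sub>1\<close> of
  \<open>K_C1\<close>.\<close>

lemma Kt_integrand_scaled:
  assumes "\<omega>\<^sub>1 > 0" "\<omega>\<^sub>2 > 0" "m \<le> q" "n \<le> p" "z > 0"
  shows "Kt_integrand m n p q a b \<omega>\<^sub>1 \<omega>\<^sub>2 (of_real \<omega>\<^sub>1 * s) *
      exp (of_real pi * \<alpha> / (of_real \<omega>\<^sub>1 * of_real \<omega>\<^sub>2) * (of_real \<omega>\<^sub>1 * s)^2) *
      of_real z powr (- (of_real \<omega>\<^sub>1 * s)) * of_real \<omega>\<^sub>1 =
    K_C1 m n p q a b \<omega>\<^sub>1 \<omega>\<^sub>2 *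
      (K_integrand (p - n) (q - m) q p (reversed_scaled q \<omega>\<^sub>1 b) (reversed_scaled p \<omega>\<^sub>1 a) (\<omega>\<^sub>2 / \<omega>\<^sub>1) s *
       exp (of_real pi * K_eta m n p q \<omega>\<^sub>2 \<alpha> / of_real (\<omega>\<^sub>2 / \<omega>\<^sub>1) * s^2) *
       exp (- s * (K_ln_C2 m n p q a b \<omega>\<^sub>1 \<omega>\<^sub>2 + of_real (\<omega>\<^sub>1 * ln z))))"
proof -
  define w1 w2 where "w1 = complex_of_real \<omega>\<^sub>1" and "w2 = complex_of_real \<omega>\<^sub>2"
  define l t where "l = complex_of_real (ln \<omega>\<^sub>2)" and "t = complex_of_real (ln (2*pi))"
  define N where "N = (of_int (K_N m n p q) :: complex)"
  define L where "L = K_ln_C2 m n p q a b \<omega>\<^sub>1 \<omega>\<^sub>2"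
  define x where "x = complex_of_real (ln z)"
  have nz: "w1 \<noteq> 0" "w2 \<noteq> 0"
    using assms by (auto simp: w1_def w2_def)
  \<comment> \<open>The part of the total exponent free of \<open>s\<close>; its exponential is
    \<open>K_C1\<close> without the factor \<open>\<omega>\<^sub>1\<close>.\<close>
  define c where "c = ((w1 + w2) * (of_nat m + of_nat n - of_nat q) - K_nu p q a b) / (2 * w1) * t
       + (- N - K_xi m n p q a b / (2 * w1 * w2) + K_mu m n p q a b * (w1 + w2) / (2 * w1 * w2)) * l"
  define E where "E = c - s * L - N * w1 * l / (2 * w2) * s^2"
  define J where "J = K_integrand (p - n) (q - m) q p (reversed_scaled q \<omega>\<^sub>1 b) (reversed_scaled p \<omega>\<^sub>1 a) (\<omega>\<^sub>2 / \<omega>\<^sub>1) s"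
  have arg: "(d - w1 * s) / w1 = d / w1 - s"
    "(w1 + w2 - d + w1 * s) / w1 = 1 + of_real (\<omega>\<^sub>2 / \<omega>\<^sub>1) - d / w1 + s" for d
    using nz by (simp_all add: diff_divide_distrib add_divide_distrib w1_def w2_def)
  have tot: "(\<Sum>j=1..m. Gamma2_exponent \<omega>\<^sub>1 \<omega>\<^sub>2 (b j - w1 * s))
       + (\<Sum>j=1..n. Gamma2_exponent \<omega>\<^sub>1 \<omega>\<^sub>2 (w1 + w2 - a j + w1 * s))
       - ((\<Sum>j=m+1..q. Gamma2_exponent \<omega>\<^sub>1 \<omega>\<^sub>2 (w1 + w2 - b j + w1 * s))
       + (\<Sum>j=n+1..p. Gamma2_exponent \<omega>\<^sub>1 \<omega>\<^sub>2 (a j - w1 * s))) = E"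
    using Gamma2_exponent_total[OF assms(1-4), of b s a]
    by (simp add: E_def c_def w1_def w2_def l_def t_def N_def L_def)
  \<comment> \<open>This holds even if some of \<open>P\<close>, \<open>Q\<close>, \<open>R\<close>,
    \<open>S\<close> vanish, since \<open>x / 0 = 0\<close>. The integrands therefore correspond at
    every \<open>s\<close>, including the zeros of \<open>barnes_G\<close>.\<close>
  have exp_quot: "exp A / P * (exp B / Q) / (exp C / R * (exp D / S)) =
      exp (A + B - (C + D)) * (S * R / (Q * P))" for A B C D P Q R S :: complex
    by (simp add: exp_diff exp_add mult_ac)
  have J: "Kt_integrand m n p q a b \<omega>\<^sub>1 \<omega>\<^sub>2 (w1 * s) = exp E * J"
    unfolding Kt_integrand_def J_def K_integrand_reversed_scaled[OF assms(3,4)]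
      w1_def[symmetric] w2_def[symmetric] prod_Gamma2[OF assms(2) finite_atLeastAtMost]
      arg exp_quot tot ..
  have C1: "K_C1 m n p q a b \<omega>\<^sub>1 \<omega>\<^sub>2 = exp c * w1"
  proof -
    have "(0::real) < 2 * pi"
      by simp
    then show ?thesis
      unfolding K_C1_def c_def w1_def w2_def l_def t_def N_def
      by (simp only: powr_of_real_pos[OF assms(2)] powr_of_real_pos[of "2 * pi"] exp_add)
  qed
  have zp: "of_real z powr (- (w1 * s)) = exp (- (w1 * s) * x)"
    using powr_of_real_pos[OF assms(5)] by (simp add: x_def)
  \<comment> \<open>Multiplied by \<pi>/\<tau>, the correction of \<alpha> in \<eta> is exactly the
    quadratic coefficient in \<open>E\<close>.\<close>
  have eta: "of_real pi * K_eta m n p q \<omega>\<^sub>2 \<alpha> / of_real (\<omega>\<^sub>2 / \<omega>\<^sub>1) =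
      of_real pi * \<alpha> * w1 / w2 - N * w1 * l / (2 * w2)"
    using nz by (simp add: K_eta_def w1_def w2_def N_def l_def field_simps)
  have expo: "E + of_real pi * \<alpha> / (w1 * w2) * (w1 * s)^2 + - (w1 * s) * x =
      c + ((of_real pi * \<alpha> * w1 / w2 - N * w1 * l / (2 * w2)) * s^2 + - s * (L + w1 * x))"
    using nz by (simp add: E_def field_simps power2_eq_square)
  have "exp E * J * exp (of_real pi * \<alpha> / (w1 * w2) * (w1 * s)^2) * exp (- (w1 * s) * x) * w1 =
      exp (E + of_real pi * \<alpha> / (w1 * w2) * (w1 * s)^2 + - (w1 * s) * x) * J * w1"
    by (simp only: exp_add mult_ac)
  also have "\<dots> = exp c * w1 * (J * exp ((of_real pi * \<alpha> * w1 / w2 - N * w1 * l / (2 * w2)) * s^2) *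
      exp (- s * (L + w1 * x)))"
    unfolding expo by (simp only: exp_add mult_ac)
  finally show ?thesis
    unfolding C1 eta w1_def[symmetric] w2_def[symmetric] zp J J_def[symmetric] L_def[symmetric]
    by (simp add: w1_def x_def)
qed

section \<open>Line integrals along scaled contours\<close>

text \<open>Each interval \<open>{-R..R}\<close> has finitely many exceptional points, and natural
  numbers \<open>R\<close> exhaust the line, so the exceptional set is countable.\<close>

lemma negligible_not_differentiable_locally_piecewise_C1:
  fixes \<gamma> :: "real \<Rightarrow> 'a::real_normed_vector"
  assumes "\<And>R. \<gamma> piecewise_C1_differentiable_on {-R..R}"
  shows "negligible {t. \<not> \<gamma> differentiable (at t)}"
proof -
  have "\<exists>S. finite S \<and> (\<forall>t\<in>{-R..R} - S. \<gamma> differentiable (at t))" for R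
    using assms[of R] by (auto simp: piecewise_C1_differentiable_on_def C1_differentiable_on_eq)
  then obtain S where S: "\<And>R. finite (S R)" "\<And>R t. t \<in> {-R..R} - S R \<Longrightarrow> \<gamma> differentiable (at t)"
    by metis
  have "{t. \<not> \<gamma> differentiable (at t)} \<subseteq> (\<Union>k::nat. S (real k))"
  proof
    fix t assume t: "t \<in> {t. \<not> \<gamma> differentiable (at t)}"
    obtain k where "\<bar>t\<bar> \<le> real k"
      using real_arch_simple by blast
    then have "t \<in> {- real k..real k}"
      by auto
    then have "t \<in> S (real k)"
      using t S(2)[of t "real k"] by auto
    then show "t \<in> (\<Union>k::nat. S (real k))"
      by blast
  qed
  moreover have "negligible (\<Union>k::nat. S (real k))"
    using S(1) by (intro negligible_countable_Union) auto
  ultimately show ?thesis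
    using negligible_subset by blast
qed

text \<open>The chain rule supplies the factor \<open>w\<close>. At corners
  \<open>vector_derivative\<close> is an unspecified value, so the integrands are compared only off
  a negligible set. An equivalence is required because the value of
  \<open>common_line_integral\<close> also depends on which integrals fail to exist.\<close>

lemma has_line_integral_scaled:
  assumes "\<And>R. \<gamma> piecewise_C1_differentiable_on {-R..R}" and "C \<noteq> 0"
    and "\<And>s. g (w * s) * w = C * f s"
  shows "has_line_integral g (C * I) (\<lambda>t. w * \<gamma> t) \<longleftrightarrow> has_line_integral f I \<gamma>"
proof -
  have "C * (f (\<gamma> t) * vector_derivative \<gamma> (at t)) = g (w * \<gamma> t) * vector_derivative (\<lambda>t. w * \<gamma> t) (at t)"
    if "t \<in> UNIV - {t. \<not> \<gamma> differentiable (at t)}" for t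
  proof -
    have "vector_derivative (\<lambda>t. w * \<gamma> t) (at t) = w * vector_derivative \<gamma> (at t)"
      using that by (intro vector_derivative_at has_vector_derivative_mult_right)
        (simp add: vector_derivative_works[symmetric])
    then show ?thesis
      using assms(3)[of "\<gamma> t"] by (simp add: mult.assoc[symmetric])
  qed
  then have "has_line_integral g (C * I) (\<lambda>t. w * \<gamma> t) \<longleftrightarrow>
      ((\<lambda>t. C * (f (\<gamma> t) * vector_derivative \<gamma> (at t))) has_integral C * I) UNIV"
    unfolding has_line_integral_def
    by (intro has_integral_spike_eq[OF negligible_not_differentiable_locally_piecewise_C1[OF assms(1)]])
  also have "\<dots> \<longleftrightarrow> has_line_integral f I \<gamma>"
    unfolding has_line_integral_def
    \<comment> \<open>Multiplication by \<open>inverse C\<close> gives the direction from left to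
      right, multiplication by \<open>C\<close> the converse.\<close>
    using has_integral_mult_right[of _ "C * I" UNIV "inverse C"] has_integral_mult_right[of _ I UNIV C] assms(2)
    by (fastforce simp: mult.assoc[symmetric])
  finally show ?thesis .
qed

text \<open>Multiplication by \<open>C\<close> is a bijection from the common values for
  \<open>f\<close> onto those for \<open>g\<close>. Unique existence is thus transferred rather than
  proved: where it fails, for instance for empty \<open>\<Gamma>\<close>, both sides take the
  default \<open>0 = C * 0\<close>.\<close>

lemma common_line_integral_transform:
  assumes "C \<noteq> 0"
    and "\<And>\<gamma> I. \<gamma> \<in> \<Gamma> \<Longrightarrow> has_line_integral g (C * I) (T \<gamma>) \<longleftrightarrow> has_line_integral f I \<gamma>"
  shows "common_line_integral {T \<gamma> | \<gamma>. \<gamma> \<in> \<Gamma>} g = C * common_line_integral \<Gamma> f"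
proof -
  define P where "P I \<longleftrightarrow> (\<forall>\<gamma>\<in>\<Gamma>. has_line_integral f I \<gamma>)" for I
  define Q where "Q I \<longleftrightarrow> (\<forall>\<gamma>\<in>{T \<gamma> | \<gamma>. \<gamma> \<in> \<Gamma>}. has_line_integral g I \<gamma>)" for I
  have PQ: "Q (C * I) \<longleftrightarrow> P I" for I
    unfolding P_def Q_def using assms(2) by auto
  have QP: "Q I \<longleftrightarrow> P (I / C)" for I
    using PQ[of "I / C"] assms(1) by simp
  have ex: "(\<exists>!I. Q I) \<longleftrightarrow> (\<exists>!I. P I)"
  proof
    assume "\<exists>!I. Q I"
    then obtain I where I: "Q I" "\<And>I'. Q I' \<Longrightarrow> I' = I"
      by blast
    show "\<exists>!I. P I"
    proof (rule ex1I[of _ "I / C"])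
      show "P (I / C)"
        using I(1) QP by simp
      show "I' = I / C" if "P I'" for I'
        using I(2)[of "C * I'"] that PQ assms(1) by (simp add: field_simps)
    qed
  next
    assume "\<exists>!I. P I"
    then obtain I where I: "P I" "\<And>I'. P I' \<Longrightarrow> I' = I"
      by blast
    show "\<exists>!I. Q I"
    proof (rule ex1I[of _ "C * I"])
      show "Q (C * I)"
        using I(1) PQ by simp
      show "I' = C * I" if "Q I'" for I'
        using I(2)[of "I' / C"] that QP assms(1) by (simp add: field_simps)
    qed
  qed
  have "(THE I. Q I) = C * (THE I. P I)" if "\<exists>!I. P I"
    using that ex PQ theI'[OF that] by (intro the1_equality) auto
  then show ?thesis
    unfolding common_line_integral_def P_def[symmetric] Q_def[symmetric] using ex by auto
qed

theorem mainTheorem13: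
  fixes \<omega>\<^sub>1 \<omega>\<^sub>2 \<tau> z :: real and \<alpha> \<eta> :: complex and m n p q :: nat
    and a b a' b' :: "nat \<Rightarrow> complex"
  assumes "\<omega>\<^sub>1 > 0" and "\<omega>\<^sub>2 > 0" and "m \<le> q" and "n \<le> p"
    and "\<tau> = \<omega>\<^sub>2 / \<omega>\<^sub>1"
    and "\<eta> = K_eta m n p q \<omega>\<^sub>2 \<alpha>"
    and "a' = reversed_scaled q \<omega>\<^sub>1 b" and "b' = reversed_scaled p \<omega>\<^sub>1 a"
    and "K_admissible (p - n) (q - m) q p a' b' \<tau> \<eta>"
    and "z > 0"
    and "K_case_vii (p - n) (q - m) q p a' b' \<eta> \<Longrightarrow> z \<noteq> 1"
  shows "Kt_fun m n p q a b \<omega>\<^sub>1 \<omega>\<^sub>2 \<alpha> z =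
    K_C1 m n p q a b \<omega>\<^sub>1 \<omega>\<^sub>2 *
    K_fun (p - n) (q - m) q p a' b' \<tau> \<eta> (K_ln_C2 m n p q a b \<omega>\<^sub>1 \<omega>\<^sub>2 + of_real (\<omega>\<^sub>1 * ln z))"
proof -
  let ?L = "K_ln_C2 m n p q a b \<omega>\<^sub>1 \<omega>\<^sub>2 + of_real (\<omega>\<^sub>1 * ln z)"
  let ?\<Gamma> = "K_contours (p - n) (q - m) q p a' b' \<tau> \<eta> ?L"
  let ?f = "\<lambda>s. K_integrand (p - n) (q - m) q p a' b' \<tau> s *
    exp (of_real pi * \<eta> / of_real \<tau> * s^2) * exp (- s * ?L)"
  let ?g = "\<lambda>s. Kt_integrand m n p q a b \<omega>\<^sub>1 \<omega>\<^sub>2 s *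
    exp (of_real pi * \<alpha> / (of_real \<omega>\<^sub>1 * of_real \<omega>\<^sub>2) * s^2) * of_real z powr (- s)"
  let ?C = "K_C1 m n p q a b \<omega>\<^sub>1 \<omega>\<^sub>2"
  have C: "?C \<noteq> 0"
    using assms(1,2) by (simp add: K_C1_def)
  have "has_line_integral ?g (?C * I) (\<lambda>t. of_real \<omega>\<^sub>1 * \<gamma> t) \<longleftrightarrow> has_line_integral ?f I \<gamma>"
    if "\<gamma> \<in> ?\<Gamma>" for \<gamma> I
  proof (rule has_line_integral_scaled[OF _ C])
    show "\<gamma> piecewise_C1_differentiable_on {-R..R}" for R
      using that by (auto simp: K_contours_def separating_contours_def)
    show "?g (of_real \<omega>\<^sub>1 * s) * of_real \<omega>\<^sub>1 = ?C * ?f s" for s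
      unfolding assms(5-8) by (rule Kt_integrand_scaled) fact+
  qed
  \<comment> \<open>By definition the contours of \<open>Kt_fun\<close> are exactly the curves
    \<open>\<omega>\<^sub>1 * \<gamma>\<close> with \<open>\<gamma>\<close> in this class, so no
    contour is deformed.\<close>
  then have "common_line_integral {\<lambda>t. of_real \<omega>\<^sub>1 * \<gamma> t | \<gamma>. \<gamma> \<in> ?\<Gamma>} ?g =
      ?C * common_line_integral ?\<Gamma> ?f"
    by (rule common_line_integral_transform[OF C])
  then show ?thesis
    unfolding Kt_fun_def K_fun_def assms(5-8) by simp
qed

end
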